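(* Let $E(n,m)$ denote the Euler numbers of the second kind. For every integer $n>0$, $$\sum_{i=0}^{n}\sum_{k=0}^{n-i}\frac{1}{k!}\,E(k,i)\binom{n-i+k-1}{n-i-k}=\frac{1}{(n-1)!}\left(n^{n-1}-(n-1)^{n-1}\right),$$ where $0^0=1$.
   Context: The Euler numbers of the second kind $E(n,m)$ (second-order Eulerian numbers, indexed so that the triangle begins with $E(1,1)=1$, OEIS A008517) are defined for integers $n\ge 0$ and $m\in\mathbb{Z}$ by $E(0,0)=1$, $E(0,m)=0$ for $m\ne 0$, and, for $n\ge 1$, $$E(n,m)=m\,E(n-1,m)+(2n-m)\,E(n-1,m-1).$$ In particular $E(1,1)=1$, $E(1,m)=0$ for $m\neq 1$, and for $n\ge1$, $E(n,m)=0$ unless $1\le m\le n$. The binomial coefficient $\binom{a}{b}$ is the usual one for integers $a\ge 0$, $b\geq 0$ (zero if $b>a$); the only term with negative upper index is $\binom{-1}{0}$ (at $i=n$, $k=0$), whose value is irrelevant because it is multiplied by $E(0,n)=0$. *)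

theory Defs
  imports Complex_Main
begin

(* Second-order Eulerian numbers in the indexing of OEIS A008517, i.e. the triangle
   starts with euler2 1 1 = 1.  The lower index ranges over all integers, so that
   "m - 1" in the recurrence is never truncated; for n >= 1 the value is 0 unless
   1 <= m <= n. *)
fun euler2 :: "nat \<Rightarrow> int \<Rightarrow> int" where
  "euler2 0 m = (if m = 0 then 1 else 0)"
| "euler2 (Suc n) m =
     m * euler2 n m + (2 * int (Suc n) - m) * euler2 n (m - 1)"

end

theory Submission
  imports Defs "HOL-Combinatorics.Stirling"
begin

text \<open>
  Write \<open>E(k,i)\<close> for \<open>euler2 k i\<close> and \<open>S\<close> for the Stirling numbers of the second kind. Both sides
  of the identity equal \<open>\<Sum>j<n. j * S(n-1,j) / (n-j)!\<close>.

  For the left-hand side, the classical generating function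
  \<open>\<Sum>j. S(k+j,j) x^j = (\<Sum>i. E(k,i) x^i) / (1-x)^(2k+1)\<close> reads, coefficient by coefficient,
  \<open>S(k+j,j) = \<Sum>i\<le>j. E(k,i) * C(2k+j-i, 2k)\<close> (\<open>Stirling_eq_euler2_sum\<close>). The sum in the theorem
  has denominators \<open>(1-x)^(2k)\<close> instead: after exchanging the order of summation, its inner
  sum for \<open>k+1\<close> in place of \<open>k\<close>, with \<open>j = n-k-1\<close>, is the sum
  \<open>\<Sum>i\<le>j. E(k+1,i) * C(2k+1+j-i, 2k+1)\<close>. The recurrence of \<open>E\<close> reduces it to \<open>j\<close> times the sum
  for \<open>S(k+j,j)\<close> (\<open>euler2_Suc_binomial_sum\<close>), so it equals \<open>j * S(n-1,j)\<close>. The same reduction,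
  followed by Pascal's rule, gives the inductive step for the formula for \<open>S(k+j,j)\<close>.

  For the right-hand side, expand \<open>n^(n-1)\<close> and \<open>(n-1)^(n-1)\<close> by
  \<open>x^m = \<Sum>j. S(m,j) * x(x-1)...(x-j+1)\<close> and subtract term by term.
\<close>

lemma euler2_neg: "m < 0 \<Longrightarrow> euler2 k m = 0"
  by (induction k arbitrary: m) auto

text \<open>
  The two coefficients on the left are those which the recurrence for \<open>euler2 (Suc k)\<close> attaches
  to \<open>euler2 k i\<close>: at index \<open>i\<close> and, through the shifted term, at index \<open>i + 1\<close>.
\<close>

lemma weighted_pascal:
  "int i * int (Suc (2 * k + d) choose Suc (2 * k)) +
     (2 * int k + 1 - int i) * int ((2 * k + d) choose Suc (2 * k)) =
   int (i + d) * int ((2 * k + d) choose (2 * k))"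
proof -
  have "Suc (2 * k) * ((2 * k + d) choose Suc (2 * k)) = d * ((2 * k + d) choose (2 * k))"
    using binomial_absorb_comp[of "2 * k + d" "2 * k"]
      binomial_absorption[of "2 * k" "2 * k + d"] by simp
  then have "int (Suc (2 * k)) * int ((2 * k + d) choose Suc (2 * k)) =
      int d * int ((2 * k + d) choose (2 * k))"
    by (metis of_nat_mult)
  then show ?thesis by (simp add: algebra_simps)
qed

lemma euler2_Suc_binomial_sum:
  "(\<Sum>i\<le>j. euler2 (Suc k) (int i) * int ((2 * k + 1 + (j - i)) choose (2 * k + 1))) =
   int j * (\<Sum>i\<le>j. euler2 k (int i) * int ((2 * k + (j - i)) choose (2 * k)))"
proof -
  let ?B = "\<lambda>i. int (Suc (2 * k + (j - i)) choose Suc (2 * k))"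
  let ?C = "\<lambda>i. int ((2 * k + (j - i)) choose Suc (2 * k))"
  \<comment> \<open>Replacing \<open>i\<close> by \<open>i + 1\<close> loses nothing: the term at \<open>i = 0\<close> on the left contains
      \<open>euler2 k (-1) = 0\<close>, and the one at \<open>i = j\<close> on the right contains \<open>C(2k, 2k+1) = 0\<close>.\<close>
  have shift: "(\<Sum>i\<le>j. (2 * int (Suc k) - int i) * euler2 k (int i - 1) * ?B i) =
      (\<Sum>i\<le>j. (2 * int k + 1 - int i) * euler2 k (int i) * ?C i)"
  proof (cases j)
    case 0
    then show ?thesis by (simp add: euler2_neg)
  next
    case (Suc l)
    have "(\<Sum>i\<le>j. (2 * int (Suc k) - int i) * euler2 k (int i - 1) * ?B i) =
        (\<Sum>i\<le>l. (2 * int (Suc k) - int (Suc i)) * euler2 k (int (Suc i) - 1) * ?B (Suc i))"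
      unfolding Suc by (subst sum.atMost_Suc_shift) (simp add: euler2_neg)
    also have "\<dots> = (\<Sum>i\<le>l. (2 * int k + 1 - int i) * euler2 k (int i) * ?C i)"
      by (rule sum.cong) (auto simp: Suc Suc_diff_le)
    also have "\<dots> = (\<Sum>i\<le>j. (2 * int k + 1 - int i) * euler2 k (int i) * ?C i)"
      unfolding Suc by simp
    finally show ?thesis .
  qed
  have "(\<Sum>i\<le>j. euler2 (Suc k) (int i) * ?B i) =
      (\<Sum>i\<le>j. int i * euler2 k (int i) * ?B i) +
      (\<Sum>i\<le>j. (2 * int (Suc k) - int i) * euler2 k (int i - 1) * ?B i)"
    unfolding sum.distrib[symmetric] by (rule sum.cong) (simp_all only: euler2.simps distrib_right)
  also have "\<dots> = (\<Sum>i\<le>j. euler2 k (int i) *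
      (int i * ?B i + (2 * int k + 1 - int i) * ?C i))"
    unfolding shift sum.distrib[symmetric] by (rule sum.cong) (simp_all add: algebra_simps)
  also have "\<dots> = (\<Sum>i\<le>j. euler2 k (int i) * (int j * int ((2 * k + (j - i)) choose (2 * k))))"
  proof (rule sum.cong)
    fix i assume "i \<in> {..j}"
    then show "euler2 k (int i) * (int i * ?B i + (2 * int k + 1 - int i) * ?C i) =
        euler2 k (int i) * (int j * int ((2 * k + (j - i)) choose (2 * k)))"
      using weighted_pascal[of i k "j - i"] by simp
  qed simp
  finally show ?thesis by (simp add: sum_distrib_left mult.left_commute)
qed

lemma Stirling_eq_euler2_sum:
  "int (Stirling (k + j) j) =
     (\<Sum>i\<le>j. euler2 k (int i) * int ((2 * k + (j - i)) choose (2 * k)))"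
proof (induction k arbitrary: j)
  case 0
  show ?case by (simp add: sum.delta)
next
  case (Suc k)
  note outer_IH = Suc.IH
  show ?case
  proof (induction j)
    case 0
    show ?case by (simp add: euler2_neg)
  next
    case (Suc j)
    let ?E = "\<lambda>i. euler2 (Suc k) (int i)"
    have "(\<Sum>i\<le>Suc j. ?E i * int ((2 * Suc k + (Suc j - i)) choose (2 * Suc k))) =
        (\<Sum>i\<le>Suc j. ?E i * int ((2 * k + 1 + (Suc j - i)) choose (2 * k + 1))) +
        (\<Sum>i\<le>Suc j. ?E i * int ((2 * k + 1 + (Suc j - i)) choose (2 * Suc k)))"
      unfolding sum.distrib[symmetric]
      by (rule sum.cong) (simp_all add: distrib_left del: euler2.simps)
    also have "(\<Sum>i\<le>Suc j. ?E i * int ((2 * k + 1 + (Suc j - i)) choose (2 * Suc k))) =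
        (\<Sum>i\<le>j. ?E i * int ((2 * Suc k + (j - i)) choose (2 * Suc k)))"
      by (simp add: Suc_diff_le binomial_eq_0 del: euler2.simps)
    also have "\<dots> = int (Stirling (Suc k + j) j)"
      using Suc.IH by simp
    also have "(\<Sum>i\<le>Suc j. ?E i * int ((2 * k + 1 + (Suc j - i)) choose (2 * k + 1))) =
        int (Suc j) * int (Stirling (k + Suc j) (Suc j))"
      by (subst euler2_Suc_binomial_sum) (simp only: outer_IH)
    finally have eq: "(\<Sum>i\<le>Suc j. ?E i * int ((2 * Suc k + (Suc j - i)) choose (2 * Suc k))) =
        int (Suc j) * int (Stirling (k + Suc j) (Suc j)) + int (Stirling (Suc k + j) j)" .
    show ?case
      unfolding eq by (simp add: algebra_simps)
  qed
qed

text \<open>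
  Powers in terms of falling factorials; \<open>fact j * (x choose j)\<close> is the falling factorial
  \<open>x (x - 1) ... (x - j + 1)\<close>.
\<close>

lemma power_eq_Stirling_sum:
  "x ^ n = (\<Sum>j\<le>n. Stirling n j * (fact j * (x choose j)))" for x :: nat
proof (induction n)
  case 0
  show ?case by simp
next
  case (Suc n)
  let ?f = "\<lambda>j. fact j * (x choose j)"
  have step: "x * ?f j = j * ?f j + ?f (Suc j)" for j
  proof (cases "j \<le> x")
    case True
    have "Suc j * (x choose Suc j) = (x - j) * (x choose j)"
      using binomial_absorb_comp[of x j] binomial_absorption[of j x] by simp
    then have "fact j * (Suc j * (x choose Suc j)) = fact j * ((x - j) * (x choose j))"
      by (rule arg_cong)
    then have "?f (Suc j) = (x - j) * ?f j"
      by (simp only: fact_Suc of_nat_id mult_ac)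
    then show ?thesis using True by (simp flip: distrib_right)
  qed (simp add: binomial_eq_0)
  have "x ^ Suc n = (\<Sum>j\<le>n. Stirling n j * (x * ?f j))"
    using Suc.IH by (simp add: sum_distrib_left mult.left_commute)
  also have "\<dots> = (\<Sum>j\<le>n. j * Stirling n j * ?f j) + (\<Sum>j\<le>n. Stirling n j * ?f (Suc j))"
    unfolding step sum.distrib[symmetric] by (rule sum.cong) (simp_all add: algebra_simps)
  also have "(\<Sum>j\<le>n. j * Stirling n j * ?f j) = (\<Sum>j\<le>Suc n. j * Stirling n j * ?f j)"
    by simp
  also have "\<dots> = (\<Sum>j\<le>n. Suc j * Stirling n (Suc j) * ?f (Suc j))"
    by (subst sum.atMost_Suc_shift) simp
  also have "\<dots> + (\<Sum>j\<le>n. Stirling n j * ?f (Suc j)) =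
      (\<Sum>j\<le>n. Stirling (Suc n) (Suc j) * ?f (Suc j))"
    unfolding sum.distrib[symmetric] by (rule sum.cong) (simp_all add: algebra_simps)
  also have "\<dots> = (\<Sum>j\<le>Suc n. Stirling (Suc n) j * ?f j)"
    by (subst sum.atMost_Suc_shift) simp
  finally show ?case .
qed

lemma Stirling_sum_eq_power_diff:
  "(\<Sum>j\<le>m. 1 / fact (Suc m - j) * (real j * real (Stirling m j))) =
   1 / fact m * (real (Suc m) ^ m - real m ^ m)"
proof -
  have "real (Suc m) ^ m - real m ^ m =
      (\<Sum>j\<le>m. real (Stirling m j) *
         (fact j * real (Suc m choose j) - fact j * real (m choose j)))"
    using arg_cong[OF power_eq_Stirling_sum[of "Suc m" m], of real]
      arg_cong[OF power_eq_Stirling_sum[of m m], of real]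
    by (simp add: sum_subtractf right_diff_distrib del: of_nat_Suc)
  also have "\<dots> = fact m * (\<Sum>j\<le>m. 1 / fact (Suc m - j) * (real j * real (Stirling m j)))"
    unfolding sum_distrib_left
  proof (rule sum.cong)
    fix j assume "j \<in> {..m}"
    then have j: "j \<le> m" by simp
    have "fact j * real (Suc m choose j) = (real m + 1) * fact m / fact (Suc m - j)"
      using j by (simp add: binomial_fact)
    moreover have "fact j * real (m choose j) = (real m + 1 - real j) * fact m / fact (Suc m - j)"
    proof -
      have "fact (Suc m - j) = (real m + 1 - real j) * fact (m - j)"
        using j by (simp add: Suc_diff_le of_nat_diff)
      moreover have "real m + 1 - real j \<noteq> 0"
        using j by linarith
      ultimately show ?thesis
        using j by (simp add: binomial_fact)
    qed
    ultimately have "fact j * real (Suc m choose j) - fact j * real (m choose j) =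
        real j * fact m / fact (Suc m - j)"
      by (simp add: algebra_simps flip: diff_divide_distrib)
    then show "real (Stirling m j) *
        (fact j * real (Suc m choose j) - fact j * real (m choose j)) =
        fact m * (1 / fact (Suc m - j) * (real j * real (Stirling m j)))"
      by simp
  qed simp
  finally show ?thesis by simp
qed

theorem mainTheorem3:
  fixes n :: nat
  assumes "n > 0"
  shows "(\<Sum>i=0..n. \<Sum>k=0..n - i.
            1 / fact k * real_of_int (euler2 k (int i)) * real ((n - i + k - 1) choose (n - i - k)))
         = 1 / fact (n - 1) * (real n ^ (n - 1) - (real n - 1) ^ (n - 1))"
proof -
  obtain m where n: "n = Suc m"
    using assms gr0_implies_Suc by blast
  let ?t = "\<lambda>i k. 1 / fact k * real_of_int (euler2 k (int i)) *
      real ((n - i + k - 1) choose (n - i - k))"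
  have "(\<Sum>i=0..n. \<Sum>k=0..n - i. ?t i k) = (\<Sum>i\<le>n. \<Sum>k\<le>n - i. ?t i k)"
    by (simp only: atMost_atLeast0)
  also have "\<dots> = (\<Sum>k\<le>n. \<Sum>i\<le>n - k. ?t i k)"
  proof -
    have "(\<Sum>i\<le>n. \<Sum>k\<le>n - i. ?t i k) = (\<Sum>i\<le>n. sum (?t i) {k. k \<in> {..n} \<and> i + k \<le> n})"
      by (intro sum.cong) auto
    also have "\<dots> = (\<Sum>k\<le>n. \<Sum>i | i \<in> {..n} \<and> i + k \<le> n. ?t i k)"
      by (rule sum.swap_restrict) simp_all
    also have "\<dots> = (\<Sum>k\<le>n. \<Sum>i\<le>n - k. ?t i k)"
      by (intro sum.cong) auto
    finally show ?thesis .
  qed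
  also have "\<dots> = (\<Sum>i\<le>n. ?t i 0) + (\<Sum>k\<le>m. \<Sum>i\<le>n - Suc k. ?t i (Suc k))"
    unfolding n by (subst sum.atMost_Suc_shift) simp
  \<comment> \<open>For \<open>k = 0\<close> only \<open>i = 0\<close> has a nonzero Eulerian number, and its binomial is \<open>C(n-1, n) = 0\<close>.\<close>
  also have "(\<Sum>i\<le>n. ?t i 0) = 0"
    by (rule sum.neutral) (simp add: n)
  also have "(\<Sum>k\<le>m. \<Sum>i\<le>n - Suc k. ?t i (Suc k)) =
      (\<Sum>k\<le>m. 1 / fact (Suc k) * (real (m - k) * real (Stirling m (m - k))))"
  proof (rule sum.cong)
    fix k assume "k \<in> {..m}"
    then obtain j where m: "m = k + j"
      using le_Suc_ex by auto
    have "(\<Sum>i\<le>n - Suc k. ?t i (Suc k)) = (\<Sum>i\<le>j. 1 / fact (Suc k) * real_of_int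
        (euler2 (Suc k) (int i) * int ((2 * k + 1 + (j - i)) choose (2 * k + 1))))"
    proof (rule sum.cong)
      fix i assume "i \<in> {..j}"
      then obtain d where "j = i + d"
        using le_Suc_ex by auto
      then show "?t i (Suc k) = 1 / fact (Suc k) * real_of_int
        (euler2 (Suc k) (int i) * int ((2 * k + 1 + (j - i)) choose (2 * k + 1)))"
        using binomial_symmetric[of d "2 * k + 1 + d"]
        by (simp add: n m mult_2 add_ac del: euler2.simps)
    qed (simp add: n m)
    also have "\<dots> = 1 / fact (Suc k) * real_of_int (int j * int (Stirling (k + j) j))"
      unfolding Stirling_eq_euler2_sum euler2_Suc_binomial_sum[symmetric]
      by (simp only: sum_distrib_left of_int_sum)
    finally show "(\<Sum>i\<le>n - Suc k. ?t i (Suc k)) =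
        1 / fact (Suc k) * (real (m - k) * real (Stirling m (m - k)))"
      by (simp add: m)
  qed simp
  also have "\<dots> = (\<Sum>j\<le>m. 1 / fact (Suc m - j) * (real j * real (Stirling m j)))"
    by (rule sum.reindex_bij_witness[of _ "\<lambda>j. m - j" "\<lambda>k. m - k"]) (auto simp: Suc_diff_le)
  finally show ?thesis
    using Stirling_sum_eq_power_diff[of m] by (simp add: n)
qed

end
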